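(* Let $\mathcal X$ and $\mathcal Y$ be topological spaces, and let $\mathfrak A\subseteq\mathfrak R(\mathcal X)$ and $\mathfrak B\subseteq\mathfrak R(\mathcal Y)$ be Boolean subalgebras of the algebras of regular open sets. Let $\phi:\mathcal X\to\mathcal Y$ be an open, continuous, $(\mathfrak A,\mathfrak B)$-measurable function, and let $g:\mathcal Y\to\mathbb R$ be any function. (a) If $g\in\mathcal F_{\mathfrak B}(\mathcal Y)$, then $g\circ\phi\in\mathcal F_{\mathfrak A}(\mathcal X)$. If $g\in\mathcal L_{\mathfrak B}(\mathcal Y)$, then $g\circ\phi\in\mathcal L_{\mathfrak A}(\mathcal X)$. If $g\in\mathcal G_{\mathfrak B}(\mathcal Y)$, then $g\circ\phi\in\mathcal G_{\mathfrak A}(\mathcal X)$. If $g\in\mathcal C_{\mathfrak B}(\mathcal Y)$, then $g\circ\phi\in\mathcal C_{\mathfrak A}(\mathcal X)$. (b) Suppose $g\in\mathcal L_{\mathfrak B}(\mathcal Y)$. Let $\mu$ be a content on $\mathfrak A$, and let $\nu:=\phi(\mu)$. For any $B\in\mathfrak B$, if $A:=\phi^{-1}(B)$, then $\fint_A g\circ\phi\,d\mu=\fint_B g\,d\nu$.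
   Context: An open set $R\subseteq\mathcal S$ of a topological space is regular if $R=\mathrm{int}(\mathrm{clos}(R))$. $\mathfrak R(\mathcal S)$ is the set of regular open subsets; it is a Boolean algebra with meet $\cap$, join $Q\vee R:=\mathrm{int}(\mathrm{clos}(Q\cup R))$ and complement $\neg R:=\mathrm{int}(\mathcal S\setminus R)$. A Boolean subalgebra is a subset closed under $\cap,\vee,\neg$. A content on a Boolean subalgebra $\mathfrak B\subseteq\mathfrak R(\mathcal S)$ is a function $\mu:\mathfrak B\to[0,\infty)$ such that $\mu[B_1\vee\cdots\vee B_N]=\sum_n\mu[B_n]$ for every finite collection of disjoint elements of $\mathfrak B$; by standing assumption $\mu[\mathcal S]=1$. Function spaces on $\mathcal S$ relative to $\mathfrak B$: a $\mathfrak B$-partition of $\mathcal S$ is a finite collection of disjoint elements of $\mathfrak B$ with join $\mathcal S$. $\mathcal F_{\mathfrak B}(\mathcal S)$ is the set of $\mathfrak B$-simple functions: those $f:\mathcal S\to\mathbb R$ that are constant on each cell of some $\mathfrak B$-partition of $\mathcal S$ (values off the cells are arbitrary). $\mathcal L_{\mathfrak B}(\mathcal S)$ is the set of $\mathfrak B$-integrable functions: bounded functions $h:\mathcal S\to\mathbb R$ that are uniform limits of $\mathfrak B$-simple functions. A function $f:\mathcal S\to\mathbb R$ is $\mathfrak B$-comeasurable if $\mathrm{int}(f^{-1}(-\infty,r])\in\mathfrak B$ and $\mathrm{int}(f^{-1}[r,\infty))\in\mathfrak B$ for all $r\in\mathbb R$. $\mathcal C_{\mathfrak B}(\mathcal S)$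 is the set of bounded, continuous, $\mathfrak B$-comeasurable functions, and $\mathcal G_{\mathfrak B}(\mathcal S)$ is the closed linear span of $\mathcal C_{\mathfrak B}(\mathcal S)$ in the Banach space of bounded continuous real-valued functions on $\mathcal S$ with the uniform norm. Integral: for a content $\mu$ on $\mathfrak B$ and $B\in\mathfrak B$, if $f$ is bounded and $\mathfrak B$-simple, with value $r_n$ on the cell $P_n$ of a $\mathfrak B$-partition $\{P_1,\dots,P_N\}$ of $\mathcal S$, then $\fint_B f\,d\mu:=\sum_n r_n\,\mu[P_n\cap B]$; for $g\in\mathcal L_{\mathfrak B}(\mathcal S)$, $\fint_B g\,d\mu$ is the supremum of $\fint_B f\,d\mu$ over all bounded $\mathfrak B$-simple $f$ with $f\le g$ on $B$. $\phi:\mathcal X\to\mathcal Y$ is $(\mathfrak A,\mathfrak B)$-measurable if $\phi^{-1}(B)\in\mathfrak A$ for all $B\in\mathfrak B$. For a content $\mu$ on $\mathfrak A$ and $\phi$ open, continuous and $(\mathfrak A,\mathfrak B)$-measurable, the image $\phi(\mu)$ is the content on $\mathfrak B$ given by $\phi(\mu)[B]:=\mu[\phi^{-1}(B)]$. *)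

theory Defs
  imports "HOL-Analysis.Analysis"
begin

text \<open>
  Topological spaces are abstract topologies, so the empty space is included. A real-valued function
  on a space \<open>X\<close> is a total HOL function of which only the values on \<open>topspace X\<close> matter. The one
  exception is \<open>closed_linear_span\<close>, whose elements are extensional representatives.
\<close>

definition regular_opens :: "'a topology \<Rightarrow> 'a set set" where
  "regular_opens X = {R. openin X R \<and> R = X interior_of (X closure_of R)}"

text \<open>The join \<open>B\<^sub>1 \<or> \<dots> \<or> B\<^sub>N\<close> in the regular open algebra, for a collection of sets.\<close>

definition regular_join :: "'a topology \<Rightarrow> 'a set set \<Rightarrow> 'a set" where
  "regular_join X \<C> = X interior_of (X closure_of (\<Union>\<C>))"

text \<open>
  Only closure under the three operations is required. A nonempty family of this kind automatically
  contains \<open>{}\<close> and \<open>topspace X\<close>; the empty family is not excluded.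
\<close>

definition boolean_subalgebra :: "'a topology \<Rightarrow> 'a set set \<Rightarrow> bool" where
  "boolean_subalgebra X \<BB> \<longleftrightarrow>
     \<BB> \<subseteq> regular_opens X \<and>
     (\<forall>Q\<in>\<BB>. \<forall>R\<in>\<BB>. Q \<inter> R \<in> \<BB>) \<and>
     (\<forall>Q\<in>\<BB>. \<forall>R\<in>\<BB>. regular_join X {Q, R} \<in> \<BB>) \<and>
     (\<forall>R\<in>\<BB>. X interior_of (topspace X - R) \<in> \<BB>)"

text \<open>The values of a content outside \<open>\<BB>\<close> are irrelevant.\<close>

definition content_on :: "'a topology \<Rightarrow> 'a set set \<Rightarrow> ('a set \<Rightarrow> real) \<Rightarrow> bool" where
  "content_on X \<BB> \<mu> \<longleftrightarrow>
     (\<forall>B\<in>\<BB>. 0 \<le> \<mu> B) \<and>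
     (\<forall>\<C>. finite \<C> \<and> \<C> \<subseteq> \<BB> \<and> pairwise disjnt \<C> \<longrightarrow> \<mu> (regular_join X \<C>) = (\<Sum>C\<in>\<C>. \<mu> C)) \<and>
     \<mu> (topspace X) = 1"

definition regular_partition :: "'a topology \<Rightarrow> 'a set set \<Rightarrow> 'a set set \<Rightarrow> bool" where
  "regular_partition X \<BB> \<P> \<longleftrightarrow>
     finite \<P> \<and> \<P> \<subseteq> \<BB> \<and> pairwise disjnt \<P> \<and> regular_join X \<P> = topspace X"

definition simple_functions :: "'a topology \<Rightarrow> 'a set set \<Rightarrow> ('a \<Rightarrow> real) set" where
  "simple_functions X \<BB> = {f. \<exists>\<P>. regular_partition X \<BB> \<P> \<and> (\<forall>P\<in>\<P>. f constant_on P)}"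

definition integrable_functions :: "'a topology \<Rightarrow> 'a set set \<Rightarrow> ('a \<Rightarrow> real) set" where
  "integrable_functions X \<BB> =
     {h. bounded (h ` topspace X) \<and>
         (\<exists>s. (\<forall>n::nat. s n \<in> simple_functions X \<BB>) \<and> uniform_limit (topspace X) s h sequentially)}"

definition comeasurable :: "'a topology \<Rightarrow> 'a set set \<Rightarrow> ('a \<Rightarrow> real) \<Rightarrow> bool" where
  "comeasurable X \<BB> f \<longleftrightarrow>
     (\<forall>r. X interior_of {x \<in> topspace X. f x \<le> r} \<in> \<BB> \<and>
          X interior_of {x \<in> topspace X. r \<le> f x} \<in> \<BB>)"

definition comeasurable_continuous :: "'a topology \<Rightarrow> 'a set set \<Rightarrow> ('a \<Rightarrow> real) set" where
  "comeasurable_continuous X \<BB> =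
     {f. bounded (f ` topspace X) \<and> continuous_map X euclideanreal f \<and> comeasurable X \<BB> f}"

text \<open>
  \<open>cfunspace X euclidean_metric\<close> is the space of bounded continuous real functions on \<open>X\<close> with the
  uniform metric. Its points are extensional functions, that is, undefined outside
  \<open>topspace X\<close>; hence the restrictions.
\<close>

definition closed_linear_span :: "'a topology \<Rightarrow> ('a \<Rightarrow> real) set \<Rightarrow> ('a \<Rightarrow> real) set" where
  "closed_linear_span X S =
     mtopology_of (cfunspace X euclidean_metric) closure_of
       {restrict (\<lambda>x. \<Sum>f\<in>T. c f * f x) (topspace X) |T c. finite T \<and> T \<subseteq> S}"

definition span_comeasurable :: "'a topology \<Rightarrow> 'a set set \<Rightarrow> ('a \<Rightarrow> real) set" where
  "span_comeasurable X \<BB> =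
     {g. restrict g (topspace X) \<in> closed_linear_span X (comeasurable_continuous X \<BB>)}"

text \<open>
  The sum does not depend on the partition or on the value assigned to an empty cell, so for
  bounded simple \<open>f\<close> the description determines a unique number.
\<close>

definition simple_integral ::
    "'a topology \<Rightarrow> 'a set set \<Rightarrow> ('a set \<Rightarrow> real) \<Rightarrow> 'a set \<Rightarrow> ('a \<Rightarrow> real) \<Rightarrow> real" where
  "simple_integral X \<BB> \<mu> B f =
     (THE I. \<exists>\<P> r. regular_partition X \<BB> \<P> \<and> (\<forall>P\<in>\<P>. \<forall>x\<in>P. f x = r P) \<and>
                   I = (\<Sum>P\<in>\<P>. r P * \<mu> (P \<inter> B)))"

definition content_integral ::
    "'a topology \<Rightarrow> 'a set set \<Rightarrow> ('a set \<Rightarrow> real) \<Rightarrow> 'a set \<Rightarrow> ('a \<Rightarrow> real) \<Rightarrow> real" where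
  "content_integral X \<BB> \<mu> B g =
     Sup {simple_integral X \<BB> \<mu> B f |f.
            f \<in> simple_functions X \<BB> \<and> bounded (f ` topspace X) \<and> (\<forall>x\<in>B. f x \<le> g x)}"

definition algebra_measurable ::
    "'a topology \<Rightarrow> 'a set set \<Rightarrow> 'b set set \<Rightarrow> ('a \<Rightarrow> 'b) \<Rightarrow> bool" where
  "algebra_measurable X \<AA> \<BB> \<phi> \<longleftrightarrow> (\<forall>B\<in>\<BB>. \<phi> -` B \<inter> topspace X \<in> \<AA>)"

definition image_content ::
    "'a topology \<Rightarrow> ('a \<Rightarrow> 'b) \<Rightarrow> ('a set \<Rightarrow> real) \<Rightarrow> 'b set \<Rightarrow> real" where
  "image_content X \<phi> \<mu> = (\<lambda>B. \<mu> (\<phi> -` B \<inter> topspace X))"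

end

theory Submission
  imports Defs
begin

text \<open>
  For an open continuous map, preimages commute with interior and closure, hence with joins of
  regular open sets; so the preimage of a \<open>\<BB>\<close>-partition is an \<open>\<AA>\<close>-partition and composition
  with \<open>\<phi>\<close> preserves simple functions and their integrals. Everything else passes to uniform
  limits: a simple \<open>f\<close> uniformly \<open>\<epsilon>\<close>-close to \<open>g\<close> satisfies
  \<open>\<bar>\<integral>\<^sub>B g - \<integral>\<^sub>B f\<bar> \<le> \<epsilon> * \<mu> B\<close>, and composition with \<open>\<phi>\<close> does not increase uniform distances.
\<close>

section \<open>Preimages under open continuous maps\<close>

text \<open>Continuity makes the left side open. Openness makes it the largest candidate: an open
  set inside the preimage of \<open>S\<close> has an open image inside \<open>S\<close>, hence
  inside the interior of \<open>S\<close>.\<close>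

lemma vimage_interior_of:
  assumes "open_map X Y \<phi>" "continuous_map X Y \<phi>" "S \<subseteq> topspace Y"
  shows "\<phi> -` (Y interior_of S) \<inter> topspace X = X interior_of (\<phi> -` S \<inter> topspace X)"
proof (rule sym, rule interior_of_unique)
  show "openin X (\<phi> -` (Y interior_of S) \<inter> topspace X)"
    using openin_continuous_map_preimage[OF assms(2), of "Y interior_of S"]
    by (simp add: vimage_def Collect_conj_eq Int_commute)
  show "\<phi> -` (Y interior_of S) \<inter> topspace X \<subseteq> \<phi> -` S \<inter> topspace X"
    using interior_of_subset[of Y S] by blast
  fix T assume T: "openin X T" "T \<subseteq> \<phi> -` S \<inter> topspace X"
  then have "openin Y (\<phi> ` T)"
    using assms(1) by (simp add: open_map_def)
  then have "\<phi> ` T \<subseteq> Y interior_of S"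
    using T(2) by (intro interior_of_maximal) auto
  then show "T \<subseteq> \<phi> -` (Y interior_of S) \<inter> topspace X"
    using T(2) by blast
qed

text \<open>Dual to \<open>vimage_interior_of\<close>: closure is the complement of the interior of
  the complement, and preimages respect complements because \<open>\<phi>\<close> maps
  \<open>topspace X\<close> into \<open>topspace Y\<close>.\<close>

lemma vimage_closure_of:
  assumes "open_map X Y \<phi>" "continuous_map X Y \<phi>" "S \<subseteq> topspace Y"
  shows "\<phi> -` (Y closure_of S) \<inter> topspace X = X closure_of (\<phi> -` S \<inter> topspace X)"
proof -
  have *: "\<phi> -` (topspace Y - U) \<inter> topspace X = topspace X - (\<phi> -` U \<inter> topspace X)" for U
    using continuous_map_image_subset_topspace[OF assms(2)] by blast
  have "Y closure_of S = topspace Y - Y interior_of (topspace Y - S)"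
    using assms(3) by (metis closure_of_complement double_diff order_refl)
  then have "\<phi> -` (Y closure_of S) \<inter> topspace X
      = topspace X - X interior_of (topspace X - (\<phi> -` S \<inter> topspace X))"
    by (simp add: * vimage_interior_of[OF assms(1,2)])
  then show ?thesis
    by (simp add: closure_of_interior_of)
qed

lemma vimage_regular_join:
  assumes "open_map X Y \<phi>" "continuous_map X Y \<phi>" "\<Union>\<C> \<subseteq> topspace Y"
  shows "\<phi> -` regular_join Y \<C> \<inter> topspace X = regular_join X ((\<lambda>C. \<phi> -` C \<inter> topspace X) ` \<C>)"
proof -
  have "(\<Union>C\<in>\<C>. \<phi> -` C \<inter> topspace X) = \<phi> -` \<Union>\<C> \<inter> topspace X"
    by blast
  then show ?thesis
    using assms
    by (simp add: regular_join_def vimage_interior_of vimage_closure_of closure_of_subset_topspace)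
qed

section \<open>Boolean subalgebras, contents and partitions\<close>

lemma boolean_subalgebraD:
  assumes "boolean_subalgebra X \<BB>"
  shows boolean_subalgebra_openin: "B \<in> \<BB> \<Longrightarrow> openin X B"
    and boolean_subalgebra_regular: "B \<in> \<BB> \<Longrightarrow> X interior_of (X closure_of B) = B"
    and boolean_subalgebra_subset: "B \<in> \<BB> \<Longrightarrow> B \<subseteq> topspace X"
    and boolean_subalgebra_Int: "B \<in> \<BB> \<Longrightarrow> C \<in> \<BB> \<Longrightarrow> B \<inter> C \<in> \<BB>"
proof -
  have "B \<in> regular_opens X" if "B \<in> \<BB>" for B
    using assms that unfolding boolean_subalgebra_def by blast
  then have *: "openin X B \<and> B = X interior_of (X closure_of B)" if "B \<in> \<BB>" for B
    using that unfolding regular_opens_def by blast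
  show "openin X B" if "B \<in> \<BB>"
    using *[OF that] by (rule conjunct1)
  then show "B \<subseteq> topspace X" if "B \<in> \<BB>"
    using that by (blast dest: openin_subset)
  show "X interior_of (X closure_of B) = B" if "B \<in> \<BB>"
    using *[OF that] by (elim conjE) (erule sym)
  show "B \<inter> C \<in> \<BB>" if "B \<in> \<BB>" "C \<in> \<BB>"
    using assms that unfolding boolean_subalgebra_def by blast
qed

text \<open>Distributivity of the regular open algebra: the join of a partition contains a dense open set,
  and a dense set meets an open set \<open>B\<close> in a dense subset of \<open>B\<close>.\<close>

lemma regular_join_partition_Int:
  assumes "boolean_subalgebra X \<BB>" "regular_partition X \<BB> \<P>" "B \<in> \<BB>"
  shows "regular_join X ((\<lambda>P. P \<inter> B) ` \<P>) = B"
proof -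
  have "X closure_of \<Union>\<P> = topspace X"
    using assms(2) closure_of_subset_topspace[of X "\<Union>\<P>"] interior_of_subset[of X "X closure_of \<Union>\<P>"]
    unfolding regular_partition_def regular_join_def by auto
  then have "X closure_of (B \<inter> \<Union>\<P>) = X closure_of B"
    using closure_of_openin_Int_closure_of[OF boolean_subalgebra_openin[OF assms(1,3)], of "\<Union>\<P>"]
      boolean_subalgebra_subset[OF assms(1,3)] by (simp add: Int_absorb2)
  moreover have "(\<Union>P\<in>\<P>. P \<inter> B) = B \<inter> \<Union>\<P>"
    by blast
  ultimately show ?thesis
    using boolean_subalgebra_regular[OF assms(1,3)] by (simp add: regular_join_def)
qed

lemma content_finite_join:
  assumes "content_on X \<BB> \<mu>" "finite \<C>" "\<C> \<subseteq> \<BB>" "pairwise disjnt \<C>"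
  shows "\<mu> (regular_join X \<C>) = (\<Sum>C\<in>\<C>. \<mu> C)"
  using assms unfolding content_on_def by (elim conjE allE[of _ \<C>] impE) auto

text \<open>Additivity is applied to the empty collection, whose join is \<open>{}\<close> and whose
  sum is zero.\<close>

lemma content_empty:
  assumes "content_on X \<BB> \<mu>"
  shows "\<mu> {} = 0"
  using content_finite_join[OF assms, of "{}"] by (simp add: regular_join_def)

text \<open>Distinct indices may share the empty set, which is why \<open>\<mu> {} = 0\<close> matters.\<close>

lemma content_sum_image:
  assumes "content_on X \<BB> \<mu>" "finite I" "\<And>i. i \<in> I \<Longrightarrow> A i \<in> \<BB>"
    and "\<And>i j. i \<in> I \<Longrightarrow> j \<in> I \<Longrightarrow> i \<noteq> j \<Longrightarrow> disjnt (A i) (A j)"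
  shows "\<mu> (regular_join X (A ` I)) = (\<Sum>i\<in>I. \<mu> (A i))"
proof -
  have "pairwise disjnt (A ` I)"
    unfolding pairwise_def using assms(4) by (metis imageE)
  then have "\<mu> (regular_join X (A ` I)) = (\<Sum>C\<in>A ` I. \<mu> C)"
    using assms(1-3) by (intro content_finite_join) auto
  also have "\<dots> = (\<Sum>i\<in>I. \<mu> (A i))"
  proof (subst sum.reindex_nontrivial[OF assms(2)])
    show "\<mu> (A i) = 0" if "i \<in> I" "j \<in> I" "i \<noteq> j" "A i = A j" for i j
      using assms(4)[OF that(1-3)] that(4) content_empty[OF assms(1)] by simp
  qed simp
  finally show ?thesis .
qed

text \<open>The traces \<open>P \<inter> B\<close> are disjoint with join \<open>B\<close>. Several
  of them may be empty and hence equal, so additivity is used in its indexed form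
  \<open>content_sum_image\<close>.\<close>

lemma content_partition:
  assumes "boolean_subalgebra X \<BB>" "content_on X \<BB> \<mu>" "regular_partition X \<BB> \<P>" "B \<in> \<BB>"
  shows "(\<Sum>P\<in>\<P>. \<mu> (P \<inter> B)) = \<mu> B"
proof -
  have "\<mu> (regular_join X ((\<lambda>P. P \<inter> B) ` \<P>)) = (\<Sum>P\<in>\<P>. \<mu> (P \<inter> B))"
  proof (rule content_sum_image[OF assms(2)])
    show "disjnt (P \<inter> B) (Q \<inter> B)" if "P \<in> \<P>" "Q \<in> \<P>" "P \<noteq> Q" for P Q
      using that assms(3) unfolding regular_partition_def pairwise_def disjnt_def by blast
  qed (use assms(3,4) boolean_subalgebra_Int[OF assms(1)] in \<open>auto simp: regular_partition_def\<close>)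
  then show ?thesis
    by (simp add: regular_join_partition_Int[OF assms(1,3,4)])
qed

section \<open>Integrals of simple functions\<close>

text \<open>Common refinement: both sums are split over the sets
  \<open>P \<inter> Q \<inter> B\<close>. Where such a set is nonempty, evaluating at one of its
  points compares \<open>r P\<close> with \<open>r' Q\<close>; where it is empty, both terms vanish.
  Independence of the partition and monotonicity of the integral both follow from this
  inequality.\<close>

lemma partition_sum_mono:
  assumes "boolean_subalgebra X \<BB>" "content_on X \<BB> \<mu>" "B \<in> \<BB>"
    and P: "regular_partition X \<BB> \<P>" and Q: "regular_partition X \<BB> \<Q>"
    and f: "\<And>P x. P \<in> \<P> \<Longrightarrow> x \<in> P \<Longrightarrow> f x = r P"
    and f': "\<And>Q x. Q \<in> \<Q> \<Longrightarrow> x \<in> Q \<Longrightarrow> f' x = r' Q"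
    and le: "\<And>x. x \<in> B \<Longrightarrow> f x \<le> f' x"
  shows "(\<Sum>P\<in>\<P>. r P * \<mu> (P \<inter> B)) \<le> (\<Sum>Q\<in>\<Q>. r' Q * \<mu> (Q \<inter> B))"
proof -
  note Int = boolean_subalgebra_Int[OF assms(1)]
  have PB: "P \<inter> B \<in> \<BB>" if "P \<in> \<P>" for P
    using that P Int assms(3) by (auto simp: regular_partition_def)
  have QB: "Q \<inter> B \<in> \<BB>" if "Q \<in> \<Q>" for Q
    using that Q Int assms(3) by (auto simp: regular_partition_def)
  have "(\<Sum>P\<in>\<P>. r P * \<mu> (P \<inter> B)) = (\<Sum>P\<in>\<P>. \<Sum>Q\<in>\<Q>. r P * \<mu> (Q \<inter> (P \<inter> B)))"
    by (intro sum.cong) (simp_all add: sum_distrib_left[symmetric] content_partition[OF assms(1,2) Q PB])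
  also have "\<dots> \<le> (\<Sum>P\<in>\<P>. \<Sum>Q\<in>\<Q>. r' Q * \<mu> (P \<inter> (Q \<inter> B)))"
  proof (intro sum_mono)
    fix P Q assume PQ: "P \<in> \<P>" "Q \<in> \<Q>"
    show "r P * \<mu> (Q \<inter> (P \<inter> B)) \<le> r' Q * \<mu> (P \<inter> (Q \<inter> B))"
    proof (cases "P \<inter> (Q \<inter> B) = {}")
      case True
      then show ?thesis
        using content_empty[OF assms(2)] by (simp add: Int_left_commute)
    next
      case False
      then obtain x where "x \<in> P" "x \<in> Q" "x \<in> B"
        by blast
      then have "r P \<le> r' Q"
        using f f' le PQ by metis
      moreover have "P \<inter> (Q \<inter> B) \<in> \<BB>"
        using PQ QB P Int by (auto simp: regular_partition_def)
      then have "0 \<le> \<mu> (P \<inter> (Q \<inter> B))"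
        using assms(2) by (simp add: content_on_def)
      ultimately show ?thesis
        by (simp add: Int_left_commute mult_right_mono)
    qed
  qed
  also have "\<dots> = (\<Sum>Q\<in>\<Q>. \<Sum>P\<in>\<P>. r' Q * \<mu> (P \<inter> (Q \<inter> B)))"
    by (rule sum.swap)
  also have "\<dots> = (\<Sum>Q\<in>\<Q>. r' Q * \<mu> (Q \<inter> B))"
    by (intro sum.cong) (simp_all add: sum_distrib_left[symmetric] content_partition[OF assms(1,2) P QB])
  finally show ?thesis .
qed

text \<open>Two representations of the same \<open>f\<close> give equal sums, by
  \<open>partition_sum_mono\<close> in both directions with \<open>f \<le> f\<close>. So the
  definite description may be evaluated on any convenient representation.\<close>

lemma simple_integral_eq:
  assumes "boolean_subalgebra X \<BB>" "content_on X \<BB> \<mu>" "B \<in> \<BB>"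
    and "regular_partition X \<BB> \<P>" "\<And>P x. P \<in> \<P> \<Longrightarrow> x \<in> P \<Longrightarrow> f x = r P"
  shows "simple_integral X \<BB> \<mu> B f = (\<Sum>P\<in>\<P>. r P * \<mu> (P \<inter> B))"
  unfolding simple_integral_def
proof (rule the_equality)
  fix I
  assume "\<exists>\<P> r. regular_partition X \<BB> \<P> \<and> (\<forall>P\<in>\<P>. \<forall>x\<in>P. f x = r P) \<and> I = (\<Sum>P\<in>\<P>. r P * \<mu> (P \<inter> B))"
  then obtain \<Q> s where Q: "regular_partition X \<BB> \<Q>" "\<And>Q x. Q \<in> \<Q> \<Longrightarrow> x \<in> Q \<Longrightarrow> f x = s Q"
    and I: "I = (\<Sum>Q\<in>\<Q>. s Q * \<mu> (Q \<inter> B))"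
    by blast
  show "I = (\<Sum>P\<in>\<P>. r P * \<mu> (P \<inter> B))"
    unfolding I
    using partition_sum_mono[OF assms(1-3) Q(1) assms(4), of f s f r, OF Q(2) assms(5)]
      partition_sum_mono[OF assms(1-4) Q(1), of f r f s, OF assms(5) Q(2)]
    by simp
qed (use assms in blast)

text \<open>Selects one value per cell. On an empty cell the value is arbitrary, and there it is
  multiplied by \<open>\<mu> {} = 0\<close>.\<close>

lemma simple_functionE:
  assumes "f \<in> simple_functions X \<BB>"
  obtains \<P> r where "regular_partition X \<BB> \<P>" "\<And>P x. P \<in> \<P> \<Longrightarrow> x \<in> P \<Longrightarrow> f x = r P"
proof -
  obtain \<P> where P: "regular_partition X \<BB> \<P>" "\<forall>P\<in>\<P>. \<exists>y. \<forall>x\<in>P. f x = y"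
    using assms unfolding simple_functions_def constant_on_def by blast
  obtain r where "\<forall>P\<in>\<P>. \<forall>x\<in>P. f x = r P"
    using bchoice[OF P(2)] by blast
  with P(1) that show thesis
    by blast
qed

lemma simple_integral_mono:
  assumes "boolean_subalgebra X \<BB>" "content_on X \<BB> \<mu>" "B \<in> \<BB>"
    and f: "f \<in> simple_functions X \<BB>" and f': "f' \<in> simple_functions X \<BB>"
    and le: "\<And>x. x \<in> B \<Longrightarrow> f x \<le> f' x"
  shows "simple_integral X \<BB> \<mu> B f \<le> simple_integral X \<BB> \<mu> B f'"
proof -
  obtain \<P> r where P: "regular_partition X \<BB> \<P>" "\<And>P x. P \<in> \<P> \<Longrightarrow> x \<in> P \<Longrightarrow> f x = r P"
    using f by (rule simple_functionE) blast
  obtain \<Q> s where Q: "regular_partition X \<BB> \<Q>" "\<And>Q x. Q \<in> \<Q> \<Longrightarrow> x \<in> Q \<Longrightarrow> f' x = s Q"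
    using f' by (rule simple_functionE) blast
  show ?thesis
    using partition_sum_mono[OF assms(1-3) P(1) Q(1), of f r f' s, OF P(2) Q(2) le]
    by (simp add: simple_integral_eq[where r=r, OF assms(1-3) P] simple_integral_eq[where r=s, OF assms(1-3) Q])
qed

lemma simple_functions_add_const:
  assumes "f \<in> simple_functions X \<BB>"
  shows "(\<lambda>x. f x + c) \<in> simple_functions X \<BB>"
proof -
  have "(\<lambda>x. f x + c) constant_on P" if "f constant_on P" for P
    using that by (auto simp: constant_on_def)
  then show ?thesis
    using assms unfolding simple_functions_def by blast
qed

text \<open>The partition for \<open>f\<close> also represents \<open>f + c\<close>, and by
  \<open>content_partition\<close> the additional terms sum to \<open>c * \<mu> B\<close>.\<close>

lemma simple_integral_add_const:
  assumes "boolean_subalgebra X \<BB>" "content_on X \<BB> \<mu>" "B \<in> \<BB>" "f \<in> simple_functions X \<BB>"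
  shows "simple_integral X \<BB> \<mu> B (\<lambda>x. f x + c) = simple_integral X \<BB> \<mu> B f + c * \<mu> B"
proof -
  obtain \<P> r where P: "regular_partition X \<BB> \<P>" "\<And>P x. P \<in> \<P> \<Longrightarrow> x \<in> P \<Longrightarrow> f x = r P"
    using assms(4) by (rule simple_functionE) blast
  have "simple_integral X \<BB> \<mu> B (\<lambda>x. f x + c) = (\<Sum>P\<in>\<P>. (r P + c) * \<mu> (P \<inter> B))"
    using P(2) by (intro simple_integral_eq[OF assms(1-3) P(1)]) simp
  also have "\<dots> = (\<Sum>P\<in>\<P>. r P * \<mu> (P \<inter> B)) + c * (\<Sum>P\<in>\<P>. \<mu> (P \<inter> B))"
    by (simp add: distrib_right sum.distrib sum_distrib_left)
  also have "\<dots> = simple_integral X \<BB> \<mu> B f + c * \<mu> B"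
    unfolding content_partition[OF assms(1,2) P(1) assms(3)]
    using simple_integral_eq[where r=r, OF assms(1-3) P] by simp
  finally show ?thesis .
qed

section \<open>Approximating the integral by simple functions\<close>

text \<open>The supremum in \<open>content_integral\<close> ranges over bounded simple functions,
  while a simple function may be unbounded off its cells. Uniform closeness to a bounded function
  rules this out.\<close>

lemma bounded_real_perturb:
  fixes f h :: "'a \<Rightarrow> real"
  assumes "bounded (h ` S)" "\<And>x. x \<in> S \<Longrightarrow> \<bar>f x - h x\<bar> \<le> c"
  shows "bounded (f ` S)"
proof -
  obtain b where "\<And>x. x \<in> S \<Longrightarrow> \<bar>h x\<bar> \<le> b"
    using assms(1) by (auto simp: bounded_iff)
  then have "\<bar>f x\<bar> \<le> b + c" if "x \<in> S" for x
    using assms(2)[OF that] that by fastforce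
  then show ?thesis
    by (auto simp: bounded_iff)
qed

text \<open>The function \<open>f - \<epsilon>\<close> competes in the supremum, and every
  competitor lies below \<open>f + \<epsilon>\<close> on \<open>B\<close>. Shifting \<open>f\<close>
  by a constant changes its integral by that constant times \<open>\<mu> B\<close>.\<close>

lemma content_integral_approx:
  assumes "boolean_subalgebra X \<BB>" "content_on X \<BB> \<mu>" "B \<in> \<BB>" "f \<in> simple_functions X \<BB>"
    and "bounded (h ` topspace X)" and close: "\<And>x. x \<in> topspace X \<Longrightarrow> \<bar>f x - h x\<bar> \<le> \<epsilon>"
  shows "\<bar>content_integral X \<BB> \<mu> B h - simple_integral X \<BB> \<mu> B f\<bar> \<le> \<epsilon> * \<mu> B"
proof -
  define S where "S = {simple_integral X \<BB> \<mu> B f |f.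
    f \<in> simple_functions X \<BB> \<and> bounded (f ` topspace X) \<and> (\<forall>x\<in>B. f x \<le> h x)}"
  have BX: "x \<in> topspace X" if "x \<in> B" for x
    using that boolean_subalgebra_subset[OF assms(1,3)] by blast
  note const = simple_functions_add_const[OF assms(4)] simple_integral_add_const[OF assms(1-4)]
  have ub: "y \<le> simple_integral X \<BB> \<mu> B f + \<epsilon> * \<mu> B" if y: "y \<in> S" for y
  proof -
    obtain u where u: "u \<in> simple_functions X \<BB>" "\<And>x. x \<in> B \<Longrightarrow> u x \<le> h x"
      and y_eq: "y = simple_integral X \<BB> \<mu> B u"
      using y unfolding S_def by blast
    have "u x \<le> f x + \<epsilon>" if "x \<in> B" for x
      using u(2)[OF that] close[OF BX[OF that]] by linarith
    then show ?thesis
      unfolding y_eq const(2)[symmetric] by (intro simple_integral_mono assms(1-3) u(1) const(1))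
  qed
  have "bounded ((\<lambda>x. f x + - \<epsilon>) ` topspace X)"
  proof (rule bounded_real_perturb[OF assms(5)])
    show "\<bar>f x + - \<epsilon> - h x\<bar> \<le> 2 * \<epsilon>" if "x \<in> topspace X" for x
      using close[OF that] by linarith
  qed
  moreover have "f x + - \<epsilon> \<le> h x" if "x \<in> B" for x
    using close[OF BX[OF that]] by linarith
  \<comment> \<open>This member gives the lower bound on \<open>Sup S\<close> and also shows that
    \<open>S\<close> is nonempty, as the upper bound on \<open>Sup S\<close> requires.\<close>
  ultimately have "simple_integral X \<BB> \<mu> B f + - \<epsilon> * \<mu> B \<in> S"
    unfolding S_def const(2)[symmetric] using const(1) by blast
  then have "simple_integral X \<BB> \<mu> B f + - \<epsilon> * \<mu> B \<le> Sup S" "Sup S \<le> simple_integral X \<BB> \<mu> B f + \<epsilon> * \<mu> B"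
    using ub by (auto intro!: cSup_upper cSup_least bdd_aboveI)
  then show ?thesis
    by (simp add: content_integral_def S_def abs_le_iff)
qed

section \<open>Partitions, simple functions and contents under composition\<close>

text \<open>Preimages preserve disjointness and, by \<open>vimage_regular_join\<close>, joins.
  Distinct cells that miss the range of \<open>\<phi>\<close> have the same empty preimage, so the
  new partition can have fewer cells.\<close>

lemma vimage_regular_partition:
  assumes "open_map X Y \<phi>" "continuous_map X Y \<phi>" "algebra_measurable X \<AA> \<BB> \<phi>"
    and "boolean_subalgebra Y \<BB>" "regular_partition Y \<BB> \<P>"
  shows "regular_partition X \<AA> ((\<lambda>P. \<phi> -` P \<inter> topspace X) ` \<P>)"
proof -
  have P: "finite \<P>" "\<P> \<subseteq> \<BB>" "pairwise disjnt \<P>" "regular_join Y \<P> = topspace Y"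
    using assms(5) by (auto simp: regular_partition_def)
  have "\<Union>\<P> \<subseteq> topspace Y"
    using P(2) boolean_subalgebra_subset[OF assms(4)] by blast
  then have "regular_join X ((\<lambda>P. \<phi> -` P \<inter> topspace X) ` \<P>) = \<phi> -` topspace Y \<inter> topspace X"
    using vimage_regular_join[OF assms(1,2)] P(4) by metis
  also have "\<dots> = topspace X"
    using continuous_map_image_subset_topspace[OF assms(2)] by blast
  finally have "regular_join X ((\<lambda>P. \<phi> -` P \<inter> topspace X) ` \<P>) = topspace X" .
  moreover have "pairwise disjnt ((\<lambda>P. \<phi> -` P \<inter> topspace X) ` \<P>)"
    using P(3) by (fastforce simp: pairwise_def disjnt_def)
  ultimately show ?thesis
    using P(1,2) assms(3) by (auto simp: regular_partition_def algebra_measurable_def)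
qed

lemma simple_functions_compose:
  assumes "open_map X Y \<phi>" "continuous_map X Y \<phi>" "algebra_measurable X \<AA> \<BB> \<phi>"
    and "boolean_subalgebra Y \<BB>" "f \<in> simple_functions Y \<BB>"
  shows "f \<circ> \<phi> \<in> simple_functions X \<AA>"
proof -
  obtain \<P> r where P: "regular_partition Y \<BB> \<P>" "\<And>P y. P \<in> \<P> \<Longrightarrow> y \<in> P \<Longrightarrow> f y = r P"
    using assms(5) by (rule simple_functionE) blast
  have "\<forall>Q\<in>(\<lambda>P. \<phi> -` P \<inter> topspace X) ` \<P>. (f \<circ> \<phi>) constant_on Q"
    using P(2) by (fastforce simp: constant_on_def)
  then show ?thesis
    using vimage_regular_partition[OF assms(1-4) P(1)] unfolding simple_functions_def by blast
qed

text \<open>The preimage of a join is the join of the preimages. Since distinct sets may both have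
  empty preimage, additivity of \<open>\<mu>\<close> is applied to a family indexed by
  \<open>\<C>\<close>.\<close>

lemma content_on_image:
  assumes "open_map X Y \<phi>" "continuous_map X Y \<phi>" "algebra_measurable X \<AA> \<BB> \<phi>"
    and "boolean_subalgebra Y \<BB>" "content_on X \<AA> \<mu>"
  shows "content_on Y \<BB> (image_content X \<phi> \<mu>)"
  unfolding content_on_def image_content_def
proof (intro conjI ballI allI impI)
  show "0 \<le> \<mu> (\<phi> -` B \<inter> topspace X)" if "B \<in> \<BB>" for B
    using that assms(3,5) by (simp add: content_on_def algebra_measurable_def)
  have "\<phi> -` topspace Y \<inter> topspace X = topspace X"
    using continuous_map_image_subset_topspace[OF assms(2)] by blast
  then show "\<mu> (\<phi> -` topspace Y \<inter> topspace X) = 1"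
    using assms(5) by (simp add: content_on_def)
  fix \<C> assume C: "finite \<C> \<and> \<C> \<subseteq> \<BB> \<and> pairwise disjnt \<C>"
  then have "\<Union>\<C> \<subseteq> topspace Y"
    using boolean_subalgebra_subset[OF assms(4)] by blast
  then have eq: "\<phi> -` regular_join Y \<C> \<inter> topspace X = regular_join X ((\<lambda>C. \<phi> -` C \<inter> topspace X) ` \<C>)"
    by (rule vimage_regular_join[OF assms(1,2)])
  show "\<mu> (\<phi> -` regular_join Y \<C> \<inter> topspace X) = (\<Sum>C\<in>\<C>. \<mu> (\<phi> -` C \<inter> topspace X))"
    unfolding eq
  proof (rule content_sum_image[OF assms(5)])
    show "disjnt (\<phi> -` C \<inter> topspace X) (\<phi> -` D \<inter> topspace X)" if "C \<in> \<C>" "D \<in> \<C>" "C \<noteq> D" for C D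
      using that C unfolding pairwise_def disjnt_def by blast
  qed (use C assms(3) in \<open>auto simp: algebra_measurable_def\<close>)
qed

text \<open>The partition for \<open>f\<close> is pulled back and the two sums are matched term by
  term. Since \<open>pre\<close> need not be injective on cells, values must be assigned to the
  preimages themselves before reindexing.\<close>

lemma simple_integral_compose:
  assumes "open_map X Y \<phi>" "continuous_map X Y \<phi>" "algebra_measurable X \<AA> \<BB> \<phi>"
    and "boolean_subalgebra X \<AA>" "boolean_subalgebra Y \<BB>" "content_on X \<AA> \<mu>"
    and "B \<in> \<BB>" "f \<in> simple_functions Y \<BB>"
  shows "simple_integral X \<AA> \<mu> (\<phi> -` B \<inter> topspace X) (f \<circ> \<phi>)
       = simple_integral Y \<BB> (image_content X \<phi> \<mu>) B f"
proof -
  obtain \<P> r where P: "regular_partition Y \<BB> \<P>" "\<And>P y. P \<in> \<P> \<Longrightarrow> y \<in> P \<Longrightarrow> f y = r P"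
    using assms(8) by (rule simple_functionE) blast
  define pre where "pre = (\<lambda>P. \<phi> -` P \<inter> topspace X)"
  \<comment> \<open>A constant value can be read off at any point of the cell; for empty
    \<open>Q\<close> this is a junk value, cancelled by \<open>\<mu> {} = 0\<close>.\<close>
  define s where "s Q = (f \<circ> \<phi>) (SOME x. x \<in> Q)" for Q
  have s: "s (pre P) = r P" if "P \<in> \<P>" "pre P \<noteq> {}" for P
  proof -
    have "(SOME x. x \<in> pre P) \<in> pre P"
      using that(2) by (simp add: some_in_eq)
    then show ?thesis
      using P(2)[OF that(1)] by (simp add: s_def pre_def)
  qed
  have fs: "(f \<circ> \<phi>) x = s Q" if Q: "Q \<in> pre ` \<P>" and x: "x \<in> Q" for Q x
  proof -
    obtain P where P': "P \<in> \<P>" "Q = pre P"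
      using Q by blast
    then have "s Q = r P" and "\<phi> x \<in> P"
      using s x by (auto simp: pre_def)
    then show ?thesis
      using P(2) P'(1) by simp
  qed
  have part: "regular_partition X \<AA> (pre ` \<P>)"
    unfolding pre_def by (rule vimage_regular_partition[OF assms(1-3,5) P(1)])
  have preB: "pre B \<in> \<AA>"
    using assms(3,7) by (simp add: pre_def algebra_measurable_def)
  have \<mu>0: "\<mu> {} = 0"
    using assms(6) by (rule content_empty)
  have "simple_integral X \<AA> \<mu> (pre B) (f \<circ> \<phi>) = (\<Sum>Q\<in>pre ` \<P>. s Q * \<mu> (Q \<inter> pre B))"
    using simple_integral_eq[OF assms(4,6) preB part] fs by blast
  also have "\<dots> = (\<Sum>P\<in>\<P>. s (pre P) * \<mu> (pre P \<inter> pre B))"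
  \<comment> \<open>Two distinct cells are disjoint, so their preimages can coincide only by being
    empty, and then the term is zero.\<close>
  proof (subst sum.reindex_nontrivial)
    fix P Q assume PQ: "P \<in> \<P>" "Q \<in> \<P>" "P \<noteq> Q" and eq: "pre P = pre Q"
    then have "P \<inter> Q = {}"
      using P(1) by (auto simp: regular_partition_def pairwise_def disjnt_def)
    with eq have "pre P = {}"
      unfolding pre_def by blast
    then show "s (pre P) * \<mu> (pre P \<inter> pre B) = 0"
      by (simp add: \<mu>0)
  qed (use P(1) in \<open>simp_all add: regular_partition_def\<close>)
  also have "\<dots> = (\<Sum>P\<in>\<P>. r P * image_content X \<phi> \<mu> (P \<inter> B))"
  proof (intro sum.cong refl)
    fix P assume "P \<in> \<P>"
    moreover have "\<phi> -` (P \<inter> B) \<inter> topspace X = pre P \<inter> pre B"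
      by (auto simp: pre_def)
    ultimately show "s (pre P) * \<mu> (pre P \<inter> pre B) = r P * image_content X \<phi> \<mu> (P \<inter> B)"
      using s \<mu>0 by (cases "pre P = {}") (simp_all add: image_content_def)
  qed
  also have "\<dots> = simple_integral Y \<BB> (image_content X \<phi> \<mu>) B f"
    using simple_integral_eq[OF assms(5) content_on_image[OF assms(1-3,5,6)] assms(7) P(1)] P(2)
    by metis
  finally show ?thesis
    by (simp add: pre_def)
qed

section \<open>Integrable and comeasurable functions under composition\<close>

text \<open>If a simple \<open>s n\<close> is uniformly \<epsilon>-close to \<open>g\<close>, then
  both integrals lie within \<open>\<epsilon> * \<mu> ?A\<close> of the same number, because the
  integrals of \<open>s n \<circ> \<phi>\<close> and \<open>s n\<close> agree and
  \<open>?\<nu> B = \<mu> ?A\<close>.\<close>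

lemma content_integral_compose:
  assumes "open_map X Y \<phi>" "continuous_map X Y \<phi>" "algebra_measurable X \<AA> \<BB> \<phi>"
    and "boolean_subalgebra X \<AA>" "boolean_subalgebra Y \<BB>" "content_on X \<AA> \<mu>"
    and "B \<in> \<BB>" "g \<in> integrable_functions Y \<BB>"
  shows "content_integral X \<AA> \<mu> (\<phi> -` B \<inter> topspace X) (g \<circ> \<phi>)
       = content_integral Y \<BB> (image_content X \<phi> \<mu>) B g" (is "?I = ?J")
proof -
  let ?\<nu> = "image_content X \<phi> \<mu>" and ?A = "\<phi> -` B \<inter> topspace X"
  have A: "?A \<in> \<AA>"
    using assms(3,7) by (simp add: algebra_measurable_def)
  have \<phi>: "\<phi> x \<in> topspace Y" if "x \<in> topspace X" for x
    using that continuous_map_image_subset_topspace[OF assms(2)] by blast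
  obtain s where s: "\<And>n::nat. s n \<in> simple_functions Y \<BB>" "uniform_limit (topspace Y) s g sequentially"
    and g: "bounded (g ` topspace Y)"
    using assms(8) by (auto simp: integrable_functions_def)
  have g\<phi>: "bounded ((g \<circ> \<phi>) ` topspace X)"
    using g by (rule bounded_subset) (use \<phi> in auto)
  have est: "\<bar>?I - ?J\<bar> \<le> 2 * (\<epsilon> * \<mu> ?A)" if \<epsilon>: "\<epsilon> > 0" for \<epsilon>
  proof -
    obtain n where "\<And>y. y \<in> topspace Y \<Longrightarrow> dist (s n y) (g y) < \<epsilon>"
      using eventually_happens'[OF sequentially_bot uniform_limitD[OF s(2) \<epsilon>]] by blast
    then have n: "\<bar>s n y - g y\<bar> \<le> \<epsilon>" if "y \<in> topspace Y" for y
      using that by (simp add: dist_real_def less_imp_le)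
    have "\<bar>?I - simple_integral X \<AA> \<mu> ?A (s n \<circ> \<phi>)\<bar> \<le> \<epsilon> * \<mu> ?A"
      using n \<phi> by (intro content_integral_approx assms g\<phi> A simple_functions_compose[OF assms(1-3,5)] s) auto
    moreover have "\<bar>?J - simple_integral Y \<BB> ?\<nu> B (s n)\<bar> \<le> \<epsilon> * ?\<nu> B"
      using n by (intro content_integral_approx assms g s content_on_image[OF assms(1-3,5,6)]) auto
    ultimately show ?thesis
      unfolding simple_integral_compose[OF assms(1-7) s(1)] by (simp add: image_content_def)
  qed
  have "\<bar>?I - ?J\<bar> \<le> 0"
  proof (rule field_le_epsilon)
    fix e :: real assume e: "e > 0"
    have "0 \<le> \<mu> ?A"
      using A assms(6) by (simp add: content_on_def)
    \<comment> \<open>Adding 1 in the denominator keeps it positive even when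
      \<open>\<mu> ?A = 0\<close>.\<close>
    then have "2 * (e / (2 * (\<mu> ?A + 1)) * \<mu> ?A) \<le> e"
      using e by (simp add: field_simps)
    then show "\<bar>?I - ?J\<bar> \<le> 0 + e"
      using est[of "e / (2 * (\<mu> ?A + 1))"] e \<open>0 \<le> \<mu> ?A\<close> by simp
  qed
  then show ?thesis
    by simp
qed

lemma integrable_functions_compose:
  assumes "open_map X Y \<phi>" "continuous_map X Y \<phi>" "algebra_measurable X \<AA> \<BB> \<phi>"
    and "boolean_subalgebra Y \<BB>" "g \<in> integrable_functions Y \<BB>"
  shows "g \<circ> \<phi> \<in> integrable_functions X \<AA>"
proof -
  have \<phi>: "\<phi> ` topspace X \<subseteq> topspace Y"
    by (rule continuous_map_image_subset_topspace[OF assms(2)])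
  obtain s where s: "\<And>n::nat. s n \<in> simple_functions Y \<BB>" "uniform_limit (topspace Y) s g sequentially"
    and g: "bounded (g ` topspace Y)"
    using assms(5) by (auto simp: integrable_functions_def)
  have "uniform_limit (topspace X) (\<lambda>n. s n \<circ> \<phi>) (g \<circ> \<phi>) sequentially"
    using s(2) \<phi> unfolding uniform_limit_iff image_subset_iff by (auto elim!: eventually_mono)
  moreover have "bounded ((g \<circ> \<phi>) ` topspace X)"
    using g by (rule bounded_subset) (use \<phi> in auto)
  ultimately show ?thesis
    using simple_functions_compose[OF assms(1-4) s(1)]
    unfolding integrable_functions_def by (auto intro!: exI[of _ "\<lambda>n. s n \<circ> \<phi>"])
qed

text \<open>Sublevel and superlevel sets of \<open>g \<circ> \<phi>\<close> are preimages of those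
  of \<open>g\<close>, and taking interiors commutes with preimages. The predicate \<open>p\<close>
  in the proof treats both kinds of half-line at once.\<close>

lemma comeasurable_continuous_compose:
  assumes "open_map X Y \<phi>" "continuous_map X Y \<phi>" "algebra_measurable X \<AA> \<BB> \<phi>"
    and "g \<in> comeasurable_continuous Y \<BB>"
  shows "g \<circ> \<phi> \<in> comeasurable_continuous X \<AA>"
proof -
  have \<phi>: "\<phi> ` topspace X \<subseteq> topspace Y"
    by (rule continuous_map_image_subset_topspace[OF assms(2)])
  have g: "bounded (g ` topspace Y)" "continuous_map Y euclideanreal g" "comeasurable Y \<BB> g"
    using assms(4) by (auto simp: comeasurable_continuous_def)
  have *: "X interior_of {x \<in> topspace X. p (g (\<phi> x))} \<in> \<AA>"
    if "Y interior_of {y \<in> topspace Y. p (g y)} \<in> \<BB>" for p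
  proof -
    have "\<phi> -` {y \<in> topspace Y. p (g y)} \<inter> topspace X = {x \<in> topspace X. p (g (\<phi> x))}"
      using \<phi> by blast
    then have "X interior_of {x \<in> topspace X. p (g (\<phi> x))}
        = \<phi> -` (Y interior_of {y \<in> topspace Y. p (g y)}) \<inter> topspace X"
      using vimage_interior_of[OF assms(1,2), of "{y \<in> topspace Y. p (g y)}"] by auto
    then show ?thesis
      using assms(3) that by (simp add: algebra_measurable_def)
  qed
  have "comeasurable X \<AA> (g \<circ> \<phi>)"
    using g(3) *[of "\<lambda>t. t \<le> r" for r] *[of "\<lambda>t. r \<le> t" for r] by (simp add: comeasurable_def)
  moreover have "bounded ((g \<circ> \<phi>) ` topspace X)"
    using g(1) by (rule bounded_subset) (use \<phi> in auto)
  ultimately show ?thesis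
    using continuous_map_compose[OF assms(2) g(2)] by (simp add: comeasurable_continuous_def)
qed

section \<open>The closed linear span\<close>

lemma restrict_in_cfunspace_iff:
  fixes h :: "'a \<Rightarrow> real"
  shows "restrict h (topspace X) \<in> mspace (cfunspace X euclidean_metric) \<longleftrightarrow>
    bounded (h ` topspace X) \<and> continuous_map X euclideanreal h"
proof -
  have "continuous_map X euclideanreal (restrict h (topspace X)) = continuous_map X euclideanreal h"
    by (auto elim!: continuous_map_eq)
  then show ?thesis
    by simp
qed

text \<open>Places the linear combinations inside the metric space, so that distances to them and
  closures can be computed there.\<close>

lemma restrict_linear_combination_in_cfunspace:
  fixes T :: "('a \<Rightarrow> real) set"
  assumes "finite T" "\<And>f. f \<in> T \<Longrightarrow> bounded (f ` topspace X)"
    and "\<And>f. f \<in> T \<Longrightarrow> continuous_map X euclideanreal f"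
  shows "restrict (\<lambda>x. \<Sum>f\<in>T. c f * f x) (topspace X) \<in> mspace (cfunspace X euclidean_metric)"
proof -
  have "bounded ((\<lambda>x. \<Sum>f\<in>T. c f * f x) ` topspace X)"
    using assms(1,2)
  proof (induction T)
    case (insert f T)
    have "bounded ((\<lambda>x. c f * f x) ` topspace X)"
      using insert.prems[of f] bounded_scaling[of "f ` topspace X" "c f"] by (simp add: image_image)
    moreover have "bounded ((\<lambda>x. \<Sum>f\<in>T. c f * f x) ` topspace X)"
      using insert by blast
    ultimately show ?case
      using insert.hyps by (simp add: bounded_plus_comp)
  qed (auto simp: bounded_iff)
  moreover have "continuous_map X euclideanreal (\<lambda>x. \<Sum>f\<in>T. c f * f x)"
    using assms(1,3) by (intro continuous_map_sum continuous_map_real_mult_left)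
  ultimately show ?thesis
    unfolding restrict_in_cfunspace_iff by blast
qed

text \<open>Distance at most \<epsilon> in the function space means pointwise difference at most
  \<epsilon> on \<open>topspace X\<close>. This replaces closure and extensional representatives by
  a criterion that can be pulled back along \<open>\<phi>\<close>.\<close>

lemma restrict_in_closed_linear_span_iff:
  fixes h :: "'a \<Rightarrow> real" and S :: "('a \<Rightarrow> real) set"
  assumes S: "\<And>f. f \<in> S \<Longrightarrow> bounded (f ` topspace X)" "\<And>f. f \<in> S \<Longrightarrow> continuous_map X euclideanreal f"
  shows "restrict h (topspace X) \<in> closed_linear_span X S \<longleftrightarrow>
    bounded (h ` topspace X) \<and> continuous_map X euclideanreal h \<and>
    (\<forall>\<epsilon>>0. \<exists>T c. finite T \<and> T \<subseteq> S \<and> (\<forall>x\<in>topspace X. \<bar>h x - (\<Sum>f\<in>T. c f * f x)\<bar> \<le> \<epsilon>))"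
proof -
  let ?M = "cfunspace X (euclidean_metric :: real metric)"
  let ?r = "\<lambda>h. restrict h (topspace X)" and ?l = "\<lambda>T c x. \<Sum>f\<in>T. c f * f x"
  have l: "?r (?l T c) \<in> mspace ?M" if "finite T" "T \<subseteq> S" for T c
    using restrict_linear_combination_in_cfunspace[of T X c] S that by blast
  have d: "mdist ?M (?r h) (?r (?l T c)) \<le> \<epsilon> \<longleftrightarrow> (\<forall>x\<in>topspace X. \<bar>h x - ?l T c x\<bar> \<le> \<epsilon>)"
    if "finite T" "T \<subseteq> S" "?r h \<in> mspace ?M" "\<epsilon> > 0" for T c \<epsilon>
  proof
    assume "mdist ?M (?r h) (?r (?l T c)) \<le> \<epsilon>"
    then show "\<forall>x\<in>topspace X. \<bar>h x - ?l T c x\<bar> \<le> \<epsilon>"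
      using mdist_cfunspace_imp_mdist_le[OF that(3) l[OF that(1,2), of c]]
      by (fastforce simp: dist_real_def)
  next
    assume "\<forall>x\<in>topspace X. \<bar>h x - ?l T c x\<bar> \<le> \<epsilon>"
    then show "mdist ?M (?r h) (?r (?l T c)) \<le> \<epsilon>"
      using that(4) by (intro mdist_cfunspace_le) (auto simp: dist_real_def)
  qed
  have "?r h \<in> closed_linear_span X S \<longleftrightarrow> ?r h \<in> mspace ?M \<and>
      (\<forall>\<epsilon>>0. \<exists>T c. finite T \<and> T \<subseteq> S \<and> mdist ?M (?r h) (?r (?l T c)) \<le> \<epsilon>)"
    \<comment> \<open>Closure is expressed with closed balls, since pointwise bounds pass to the
      supremum only as non-strict inequalities.\<close>
    unfolding closed_linear_span_def mtopology_of_def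
      Metric_space.metric_closure_of_alt[OF Metric_space_mspace_mdist]
    using l by (simp add: Metric_space.in_mcball[OF Metric_space_mspace_mdist] del: mspace_cfunspace) blast
  also have "\<dots> \<longleftrightarrow> ?r h \<in> mspace ?M \<and>
      (\<forall>\<epsilon>>0. \<exists>T c. finite T \<and> T \<subseteq> S \<and> (\<forall>x\<in>topspace X. \<bar>h x - ?l T c x\<bar> \<le> \<epsilon>))"
    using d by meson
  finally show ?thesis
    unfolding restrict_in_cfunspace_iff by blast
qed

lemma span_comeasurable_iff:
  "g \<in> span_comeasurable X \<BB> \<longleftrightarrow> bounded (g ` topspace X) \<and> continuous_map X euclideanreal g \<and>
    (\<forall>\<epsilon>>0. \<exists>T c. finite T \<and> T \<subseteq> comeasurable_continuous X \<BB> \<and>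
      (\<forall>x\<in>topspace X. \<bar>g x - (\<Sum>f\<in>T. c f * f x)\<bar> \<le> \<epsilon>))"
proof -
  have "bounded (f ` topspace X)" "continuous_map X euclideanreal f"
    if "f \<in> comeasurable_continuous X \<BB>" for f
    using that by (simp_all add: comeasurable_continuous_def)
  note * = restrict_in_closed_linear_span_iff[of "comeasurable_continuous X \<BB>" X g, OF this]
  show ?thesis
    using * unfolding span_comeasurable_def by simp
qed

text \<open>Composition with \<open>\<phi>\<close> is linear, does not increase uniform distances
  and preserves comeasurable continuous functions, so it carries approximating combinations for
  \<open>g\<close> to ones for \<open>g \<circ> \<phi>\<close>.\<close>

lemma span_comeasurable_compose:
  assumes "open_map X Y \<phi>" "continuous_map X Y \<phi>" "algebra_measurable X \<AA> \<BB> \<phi>"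
    and "g \<in> span_comeasurable Y \<BB>"
  shows "g \<circ> \<phi> \<in> span_comeasurable X \<AA>"
  unfolding span_comeasurable_iff
proof (intro conjI allI impI)
  have \<phi>: "\<phi> ` topspace X \<subseteq> topspace Y"
    by (rule continuous_map_image_subset_topspace[OF assms(2)])
  have g: "bounded (g ` topspace Y)" "continuous_map Y euclideanreal g"
    using assms(4) by (auto simp: span_comeasurable_iff)
  show "bounded ((g \<circ> \<phi>) ` topspace X)"
    using g(1) by (rule bounded_subset) (use \<phi> in auto)
  show "continuous_map X euclideanreal (g \<circ> \<phi>)"
    using continuous_map_compose[OF assms(2) g(2)] .
  fix \<epsilon> :: real assume \<epsilon>: "\<epsilon> > 0"
  have "\<exists>T c. finite T \<and> T \<subseteq> comeasurable_continuous Y \<BB> \<and>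
      (\<forall>y\<in>topspace Y. \<bar>g y - (\<Sum>f\<in>T. c f * f y)\<bar> \<le> \<epsilon>)"
    using assms(4) \<epsilon> by (simp add: span_comeasurable_iff)
  then obtain T c where T: "finite T" "T \<subseteq> comeasurable_continuous Y \<BB>"
    and le: "\<And>y. y \<in> topspace Y \<Longrightarrow> \<bar>g y - (\<Sum>f\<in>T. c f * f y)\<bar> \<le> \<epsilon>"
    by (elim exE conjE) blast
  let ?T = "(\<lambda>f. f \<circ> \<phi>) ` T"
  \<comment> \<open>Composition with \<open>\<phi>\<close> may identify members of \<open>T\<close>, so coefficients are added up along fibres.\<close>
  define c' where "c' k = (\<Sum>f | f \<in> T \<and> f \<circ> \<phi> = k. c f)" for k
  have "(\<Sum>k\<in>?T. c' k * k x) = (\<Sum>f\<in>T. c f * f (\<phi> x))" for x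
  proof -
    have "c' k * k x = (\<Sum>f | f \<in> T \<and> f \<circ> \<phi> = k. c f * f (\<phi> x))" for k
      unfolding c'_def sum_distrib_right by (rule sum.cong) auto
    then show ?thesis
      by (simp add: sum.image_gen[OF T(1), of "\<lambda>f. c f * f (\<phi> x)" "\<lambda>f. f \<circ> \<phi>"])
  qed
  then have "\<forall>x\<in>topspace X. \<bar>(g \<circ> \<phi>) x - (\<Sum>k\<in>?T. c' k * k x)\<bar> \<le> \<epsilon>"
    using le \<phi> by auto
  moreover have "finite ?T" "?T \<subseteq> comeasurable_continuous X \<AA>"
    using T comeasurable_continuous_compose[OF assms(1-3)] by auto
  ultimately show "\<exists>T c. finite T \<and> T \<subseteq> comeasurable_continuous X \<AA> \<and>
      (\<forall>x\<in>topspace X. \<bar>(g \<circ> \<phi>) x - (\<Sum>f\<in>T. c f * f x)\<bar> \<le> \<epsilon>)"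
    by blast
qed

theorem proposition5p3:
  fixes X :: "'a topology" and Y :: "'b topology"
    and \<AA> :: "'a set set" and \<BB> :: "'b set set"
    and \<phi> :: "'a \<Rightarrow> 'b" and g :: "'b \<Rightarrow> real"
  assumes "boolean_subalgebra X \<AA>" and "boolean_subalgebra Y \<BB>"
    and "open_map X Y \<phi>" and "continuous_map X Y \<phi>" and "algebra_measurable X \<AA> \<BB> \<phi>"
  shows "(g \<in> simple_functions Y \<BB> \<longrightarrow> g \<circ> \<phi> \<in> simple_functions X \<AA>) \<and>
         (g \<in> integrable_functions Y \<BB> \<longrightarrow> g \<circ> \<phi> \<in> integrable_functions X \<AA>) \<and>
         (g \<in> span_comeasurable Y \<BB> \<longrightarrow> g \<circ> \<phi> \<in> span_comeasurable X \<AA>) \<and>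
         (g \<in> comeasurable_continuous Y \<BB> \<longrightarrow> g \<circ> \<phi> \<in> comeasurable_continuous X \<AA>) \<and>
         (g \<in> integrable_functions Y \<BB> \<longrightarrow>
            (\<forall>\<mu>. content_on X \<AA> \<mu> \<longrightarrow>
              (\<forall>B\<in>\<BB>. content_integral X \<AA> \<mu> (\<phi> -` B \<inter> topspace X) (g \<circ> \<phi>) =
                       content_integral Y \<BB> (image_content X \<phi> \<mu>) B g)))"
  using simple_functions_compose[OF assms(3-5,2)] integrable_functions_compose[OF assms(3-5,2)]
    span_comeasurable_compose[OF assms(3-5)] comeasurable_continuous_compose[OF assms(3-5)]
    content_integral_compose[OF assms(3-5,1,2)]
  by blast

end
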